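(* For every $n\ge2$, the complete graph $K_n$ occurs as a minor of some primitive divergent graph in $\phi^4$ theory.
   Context: Graphs are finite undirected multigraphs; $e_G$ is the number of edges and $h_G$ the number of independent cycles of $G$. A subgraph is defined by a subset of the edges. $G$ is primitive divergent if $e_G=2h_G$ and $e_\gamma>2h_\gamma$ for every strict (non-empty) subgraph $\gamma\subsetneq G$. $G$ is in $\phi^4$ (theory) if every vertex has degree at most $4$. A minor of $G$ is a graph obtained by deleting and contracting edges. $K_n$ has vertices $v_1,\dots,v_n$ and exactly one edge $\{v_i,v_j\}$ for each $1\le i<j\le n$. *)

theory Defs
  imports Complex_Main "HOL-Library.Uprod" "HOL-Library.Z2" "HOL-Library.Function_Algebras"
begin

(* Parallel edges are distinct edges with the same ends; a loop at v has ends Upair v v.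
   Only the values of ends on edges are meaningful. *)
record ('v, 'e) multigraph =
  verts :: "'v set"
  edges :: "'e set"
  ends :: "'e \<Rightarrow> 'v uprod"

definition finite_multigraph :: "('v, 'e) multigraph \<Rightarrow> bool" where
  "finite_multigraph G \<longleftrightarrow>
     finite (verts G) \<and> finite (edges G) \<and> (\<forall>e\<in>edges G. set_uprod (ends G e) \<subseteq> verts G)"

(* The second summand makes a loop count twice. *)
definition degree :: "('v, 'e) multigraph \<Rightarrow> 'v \<Rightarrow> nat" where
  "degree G v = card {e \<in> edges G. v \<in> set_uprod (ends G e)} + card {e \<in> edges G. ends G e = Upair v v}"

definition edge_subgraph :: "('v, 'e) multigraph \<Rightarrow> 'e set \<Rightarrow> ('v, 'e) multigraph" where
  "edge_subgraph G F = \<lparr>verts = verts G, edges = F, ends = ends G\<rparr>"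

text \<open>
  The number of independent cycles is the first Betti number, computed here over the field with two
  elements (its value does not depend on the field, nor on isolated vertices). A loop has zero
  boundary, so only proper edges enter the condition at a vertex.
\<close>

definition scale_bit :: "bit \<Rightarrow> ('e \<Rightarrow> bit) \<Rightarrow> 'e \<Rightarrow> bit" where
  "scale_bit a c = (\<lambda>e. a * c e)"

lemma vector_space_scale_bit: "vector_space scale_bit"
  by unfold_locales (auto simp: scale_bit_def fun_eq_iff algebra_simps)

definition cycle_space :: "('v, 'e) multigraph \<Rightarrow> ('e \<Rightarrow> bit) set" where
  "cycle_space G = {c. (\<forall>e. e \<notin> edges G \<longrightarrow> c e = 0) \<and>
     (\<forall>v\<in>verts G. (\<Sum>e \<in> {e \<in> edges G. proper_uprod (ends G e) \<and> v \<in> set_uprod (ends G e)}. c e) = 0)}"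

definition cycle_number :: "('v, 'e) multigraph \<Rightarrow> nat" where
  "cycle_number G = vector_space.dim scale_bit (cycle_space G)"

definition primitive_divergent :: "('v, 'e) multigraph \<Rightarrow> bool" where
  "primitive_divergent G \<longleftrightarrow>
     card (edges G) = 2 * cycle_number G \<and>
     (\<forall>F. F \<noteq> {} \<and> F \<subset> edges G \<longrightarrow> card F > 2 * cycle_number (edge_subgraph G F))"

definition in_phi4 :: "('v, 'e) multigraph \<Rightarrow> bool" where
  "in_phi4 G \<longleftrightarrow> (\<forall>v\<in>verts G. degree G v \<le> 4)"

definition delete_edge :: "('v, 'e) multigraph \<Rightarrow> 'e \<Rightarrow> ('v, 'e) multigraph" where
  "delete_edge G e = edge_subgraph G (edges G - {e})"

(* For an edge e with ends a and b; the merged vertex is called a.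
   If a = b, contraction is the same as deletion. *)
definition contract_edge :: "('v, 'e) multigraph \<Rightarrow> 'e \<Rightarrow> 'v \<Rightarrow> 'v \<Rightarrow> ('v, 'e) multigraph" where
  "contract_edge G e a b =
     (let r = (\<lambda>x. if x = b then a else x)
      in \<lparr>verts = r ` verts G, edges = edges G - {e}, ends = (\<lambda>f. map_uprod r (ends G f))\<rparr>)"

(* Vertices are never deleted, only merged. *)
(* Vertices are merged but never deleted. *)
inductive has_minor :: "('v, 'e) multigraph \<Rightarrow> ('v, 'e) multigraph \<Rightarrow> bool" for G where
  refl: "has_minor G G"
| delete: "has_minor G H \<Longrightarrow> e \<in> edges H \<Longrightarrow> has_minor G (delete_edge H e)"
| contract: "has_minor G H \<Longrightarrow> e \<in> edges H \<Longrightarrow> ends H e = Upair a b \<Longrightarrow>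
    has_minor G (contract_edge H e a b)"

definition multigraph_iso :: "('v, 'e) multigraph \<Rightarrow> ('w, 'f) multigraph \<Rightarrow> bool" where
  "multigraph_iso G H \<longleftrightarrow> (\<exists>\<phi> \<psi>. bij_betw \<phi> (verts G) (verts H) \<and> bij_betw \<psi> (edges G) (edges H) \<and>
     (\<forall>e\<in>edges G. ends H (\<psi> e) = map_uprod \<phi> (ends G e)))"

definition occurs_as_minor_of :: "('w, 'f) multigraph \<Rightarrow> ('v, 'e) multigraph \<Rightarrow> bool" where
  "occurs_as_minor_of K G \<longleftrightarrow> (\<exists>H. has_minor G H \<and> multigraph_iso H K)"

definition complete_graph :: "nat \<Rightarrow> (nat, nat \<times> nat) multigraph" where
  "complete_graph n =
     \<lparr>verts = {1..n}, edges = {(i, j). 1 \<le> i \<and> i < j \<and> j \<le> n}, ends = (\<lambda>(i, j). Upair i j)\<rparr>"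

end

theory Submission
  imports Defs "HOL-Combinatorics.Transposition"
begin

text \<open>
  Let \<open>G\<close> be the union of two edge-disjoint Hamiltonian paths on \<open>{0..N}\<close>, the first visiting the
  vertices in increasing order, the second in the order given by a permutation \<open>\<pi>\<close>. All degrees are at
  most 4. As each path is a spanning tree, \<open>h\<close> of a subgraph \<open>F\<close> is at most the number of edges of \<open>F\<close>
  off either path, so \<open>2 h \<le> |F|\<close>. In the case of equality \<open>F\<close> is closed under fundamental cycles with
  respect to both paths; hence \<open>G\<close> is primitive divergent as soon as only the trivial edge sets are closed.

  To get \<open>K\<^sub>n\<close>, arrange the vertices in a grid that the first path traverses row by row, and let \<open>\<pi>\<close>
  traverse it column by column from right to left. In each column the rows other than the first and the
  last are permuted, so that any two of these \<open>n\<close> rows are consecutive in some column. Contracting the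
  rows (the first and the last one together with their neighbours) leaves a graph containing \<open>K\<^sub>n\<close>.
\<close>

subsection \<open>Cycle spaces and cobases\<close>

interpretation bit_space: vector_space scale_bit
  by (rule vector_space_scale_bit)

text \<open>The mod 2 boundary operator. The incidence condition sits in the summand, so that sums
  at all vertices run over the same set \<open>edges G\<close>.\<close>

definition boundary :: "('v, 'e) multigraph \<Rightarrow> ('e \<Rightarrow> bit) \<Rightarrow> 'v \<Rightarrow> bit" where
  "boundary G c v = (\<Sum>e\<in>edges G. if proper_uprod (ends G e) \<and> v \<in> set_uprod (ends G e) then c e else 0)"

text \<open>Bits are treated as elements of a field, not rewritten to Boolean operations.\<close>

declare add_bit_eq_xor [simp del] mult_bit_eq_and [simp del]

lemma bit_add_self [simp]: "x + x = (0 :: bit)"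
  by (cases x) auto

lemma cycle_space_iff:
  assumes "finite (edges G)"
  shows "c \<in> cycle_space G \<longleftrightarrow> (\<forall>e. e \<notin> edges G \<longrightarrow> c e = 0) \<and> (\<forall>v\<in>verts G. boundary G c v = 0)"
  using assms by (simp add: cycle_space_def boundary_def sum.inter_filter)

lemma boundary_add: "boundary G (c + d) v = boundary G c v + boundary G d v"
  unfolding boundary_def sum.distrib [symmetric] by (rule sum.cong) auto

lemma boundary_scale: "boundary G (scale_bit x c) v = x * boundary G c v"
  unfolding boundary_def scale_bit_def sum_distrib_left by (rule sum.cong) auto

lemma boundary_zero: "boundary G 0 v = 0"
  by (auto simp: boundary_def intro: sum.neutral)

lemma sum_fun_apply: "(\<Sum>i\<in>I. f i) x = (\<Sum>i\<in>I. f i x)"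
  by (induction I rule: infinite_finite_induct) auto

lemma subspace_cycle_space:
  assumes "finite (edges G)"
  shows "bit_space.subspace (cycle_space G)"
  by (rule bit_space.subspaceI)
    (auto simp: cycle_space_iff [OF assms] boundary_add boundary_scale boundary_zero, auto simp: scale_bit_def)

text \<open>The vertices stay the same, and a chain vanishing off \<open>F\<close> has the same
  boundary in both graphs. So the cycle spaces of all subgraphs lie in that of
  \<open>G\<close>.\<close>

lemma cycle_space_edge_subgraph:
  assumes "finite (edges G)" "F \<subseteq> edges G"
  shows "cycle_space (edge_subgraph G F) = {c \<in> cycle_space G. \<forall>e. e \<notin> F \<longrightarrow> c e = 0}"
proof -
  have fin: "finite (edges (edge_subgraph G F))"
    and sub: "verts (edge_subgraph G F) = verts G" "edges (edge_subgraph G F) = F"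
    using assms by (auto simp: edge_subgraph_def intro: finite_subset)
  have bd: "boundary (edge_subgraph G F) c = boundary G c" if "\<forall>e. e \<notin> F \<longrightarrow> c e = 0" for c
  proof
    fix v
    show "boundary (edge_subgraph G F) c v = boundary G c v"
      unfolding boundary_def using assms that
      by (intro sum.mono_neutral_cong_left) (auto simp: edge_subgraph_def)
  qed
  show ?thesis
  proof (rule set_eqI)
    fix c
    have "c \<in> cycle_space (edge_subgraph G F) \<longleftrightarrow>
        (\<forall>e. e \<notin> F \<longrightarrow> c e = 0) \<and> (\<forall>v\<in>verts G. boundary G c v = 0)"
      unfolding cycle_space_iff [OF fin] sub using bd by metis
    also have "\<dots> \<longleftrightarrow> (\<forall>e. e \<notin> F \<longrightarrow> c e = 0) \<and> c \<in> cycle_space G"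
      unfolding cycle_space_iff [OF assms(1)] using assms(2) by blast
    finally show "c \<in> cycle_space (edge_subgraph G F) \<longleftrightarrow> c \<in> {c \<in> cycle_space G. \<forall>e. e \<notin> F \<longrightarrow> c e = 0}"
      by blast
  qed
qed

text \<open>Abstracts the fundamental cycles of a spanning tree: \<open>B\<close> consists of the
  chords, \<open>C b\<close> is the cycle closed by \<open>b\<close>, and the last axiom says that
  the complement of \<open>B\<close> carries no cycle.\<close>

locale cycle_basis =
  fixes G :: "('v, 'e) multigraph" and B :: "'e set" and C :: "'e \<Rightarrow> 'e \<Rightarrow> bit"
  assumes finite_edges: "finite (edges G)"
    and cobasis_subset: "B \<subseteq> edges G"
    and cycle: "b \<in> B \<Longrightarrow> C b \<in> cycle_space G"
    and cycle_on_cobasis: "b \<in> B \<Longrightarrow> b' \<in> B \<Longrightarrow> C b b' = of_bool (b = b')"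
    and acyclic: "c \<in> cycle_space G \<Longrightarrow> (\<And>b. b \<in> B \<Longrightarrow> c b = 0) \<Longrightarrow> c = 0"
begin

lemma finite_cobasis: "finite B"
  using finite_edges cobasis_subset by (rule finite_subset [rotated])

text \<open>The difference of both sides is a cycle vanishing on \<open>B\<close>.\<close>

lemma cycle_expansion:
  assumes "c \<in> cycle_space G"
  shows "c = (\<Sum>b\<in>B. scale_bit (c b) (C b))"
proof -
  let ?d = "\<Sum>b\<in>B. scale_bit (c b) (C b)"
  have "?d \<in> cycle_space G"
    by (intro bit_space.subspace_sum bit_space.subspace_scale subspace_cycle_space finite_edges cycle)
  then have "c - ?d \<in> cycle_space G"
    by (intro bit_space.subspace_diff subspace_cycle_space finite_edges assms)
  moreover have "(c - ?d) b = 0" if "b \<in> B" for b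
  proof -
    have "?d b = (\<Sum>b'\<in>B. if b' = b then c b' else 0)"
      unfolding sum_fun_apply scale_bit_def
      using that by (intro sum.cong) (auto simp: cycle_on_cobasis)
    then show ?thesis
      using that finite_cobasis by simp
  qed
  ultimately have "c - ?d = 0"
    by (rule acyclic)
  then show ?thesis
    by simp
qed

text \<open>The cycles restrict to an identity matrix on \<open>B\<close>, so evaluating a linear
  combination at \<open>b\<close> reads off its coefficient.\<close>

lemma independent_cycles: "bit_space.independent (C ` B)" and inj_on_cycles: "inj_on C B"
proof -
  show inj: "inj_on C B"
  proof (rule inj_onI)
    fix b b' assume "b \<in> B" "b' \<in> B" "C b = C b'"
    then show "b = b'"
      using cycle_on_cobasis [of b b] cycle_on_cobasis [of b' b] by (cases "b' = b") auto
  qed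
  have "u b = 0" if "(\<Sum>b\<in>B. scale_bit (u b) (C b)) = 0" "b \<in> B" for u b
  proof -
    have "(\<Sum>b'\<in>B. scale_bit (u b') (C b')) b = (\<Sum>b'\<in>B. if b' = b then u b' else 0)"
      unfolding sum_fun_apply scale_bit_def
      using that by (intro sum.cong) (auto simp: cycle_on_cobasis)
    then show ?thesis
      using that finite_cobasis by simp
  qed
  then show "bit_space.independent (C ` B)"
    using inj finite_cobasis
    by (intro bit_space.independent_if_scalars_zero) (auto simp: sum.reindex)
qed

lemma cycle_number_eq: "cycle_number G = card B"
proof -
  have "cycle_space G \<subseteq> bit_space.span (C ` B)"
  proof
    fix c assume "c \<in> cycle_space G"
    then show "c \<in> bit_space.span (C ` B)"
      by (subst cycle_expansion) (assumption, intro bit_space.span_sum bit_space.span_scale bit_space.span_base imageI)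
  qed
  then show ?thesis
    unfolding cycle_number_def using cycle independent_cycles
    by (intro bit_space.dim_unique [of "C ` B"]) (auto simp: card_image inj_on_cycles)
qed

text \<open>The coefficient of \<open>C b\<close> in the expansion of \<open>c\<close> is
  \<open>c b\<close>, which is 0 for chords outside \<open>F\<close>.\<close>

lemma cycle_space_subgraph_le_span:
  assumes "F \<subseteq> edges G"
  shows "cycle_space (edge_subgraph G F) \<subseteq> bit_space.span (C ` (F \<inter> B))"
proof
  fix c assume "c \<in> cycle_space (edge_subgraph G F)"
  then have c: "c \<in> cycle_space G" "\<And>e. e \<notin> F \<Longrightarrow> c e = 0"
    using cycle_space_edge_subgraph [OF finite_edges assms] by auto
  have "scale_bit (c b) (C b) \<in> bit_space.span (C ` (F \<inter> B))" if "b \<in> B" for b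
  proof (cases "b \<in> F")
    case True
    then show ?thesis
      using that by (intro bit_space.span_scale bit_space.span_base) auto
  next
    case False
    then show ?thesis
      using c(2) by (simp add: bit_space.span_zero)
  qed
  then show "c \<in> bit_space.span (C ` (F \<inter> B))"
    by (subst cycle_expansion [OF c(1)]) (auto intro!: bit_space.span_sum)
qed

lemma cycle_number_subgraph_le:
  assumes "F \<subseteq> edges G"
  shows "cycle_number (edge_subgraph G F) \<le> card (F \<inter> B)"
proof -
  have "cycle_number (edge_subgraph G F) \<le> card (C ` (F \<inter> B))"
    unfolding cycle_number_def using finite_cobasis
    by (intro bit_space.dim_le_card cycle_space_subgraph_le_span assms) auto
  also have "\<dots> \<le> card (F \<inter> B)"
    by (intro card_image_le) (simp add: finite_cobasis)
  finally show ?thesis .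
qed

text \<open>In the case of equality the cycle space of \<open>F\<close> has the same dimension as
  the span of the \<open>C b\<close> containing it, so each of these \<open>C b\<close> is a cycle
  of \<open>F\<close> and is supported on \<open>F\<close>.\<close>

lemma cycle_in_subgraph:
  assumes "F \<subseteq> edges G" "cycle_number (edge_subgraph G F) = card (F \<inter> B)" "b \<in> F \<inter> B" "C b e \<noteq> 0"
  shows "e \<in> F"
proof -
  let ?T = "C ` (F \<inter> B)" and ?Z = "cycle_space (edge_subgraph G F)"
  have Z: "bit_space.subspace ?Z"
    using assms(1) finite_edges
    by (intro subspace_cycle_space) (auto simp: edge_subgraph_def intro: finite_subset)
  have fin: "finite ?T"
    by (simp add: finite_cobasis)
  obtain S where S: "S \<subseteq> ?Z" "bit_space.independent S" "card S = bit_space.dim ?Z"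
    by (rule bit_space.basis_exists [of ?Z])
  have span: "S \<subseteq> bit_space.span ?T"
    using S(1) cycle_space_subgraph_le_span [OF assms(1)] by blast
  have card: "card S = card ?T"
    using S(3) assms(2) inj_on_subset [OF inj_on_cycles] by (simp add: cycle_number_def card_image)
  have "C b \<in> bit_space.span S"
  proof (rule ccontr)
    assume notin: "C b \<notin> bit_space.span S"
    \<comment> \<open>Adjoining \<open>C b\<close> would give more independent vectors in the span
      of \<open>?T\<close> than \<open>?T\<close> has elements.\<close>
    then have "bit_space.independent (insert (C b) S)"
      using S(2) by (rule bit_space.independent_insertI)
    moreover have "insert (C b) S \<subseteq> bit_space.span ?T"
      using span assms(3) by (simp add: bit_space.span_base)
    ultimately have "finite (insert (C b) S) \<and> card (insert (C b) S) \<le> card ?T"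
      by (intro bit_space.independent_span_bound fin)
    moreover have "C b \<notin> S"
      using notin by (auto dest: bit_space.span_base)
    ultimately show False
      using card by (auto simp: card_insert_if)
  qed
  then have "C b \<in> ?Z"
    using bit_space.span_minimal [OF S(1) Z] by blast
  then show ?thesis
    using assms(4) cycle_space_edge_subgraph [OF finite_edges assms(1)] by auto
qed

end

subsection \<open>Fundamental cycles of a Hamiltonian path\<close>

definition edge_chain :: "'e \<Rightarrow> 'e \<Rightarrow> bit" where
  "edge_chain e = (\<lambda>x. of_bool (x = e))"

lemma boundary_edge_chain:
  assumes "finite (edges G)" "e \<in> edges G" "ends G e = Upair u v"
  shows "boundary G (edge_chain e) x = of_bool (x = u) + of_bool (x = v)"
proof -
  have "boundary G (edge_chain e) x = (\<Sum>f\<in>edges G. if f = e then of_bool (u \<noteq> v \<and> x \<in> {u, v}) else 0)"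
    unfolding boundary_def using assms(3) by (intro sum.cong) (auto simp: edge_chain_def)
  also have "\<dots> = of_bool (u \<noteq> v \<and> x \<in> {u, v})"
    using assms(1,2) by simp
  also have "\<dots> = of_bool (x = u) + of_bool (x = v)"
    by auto
  finally show ?thesis .
qed

text \<open>Telescopes the boundary of a path: an inner vertex is met twice and cancels.\<close>

lemma bit_add_cancel_middle: "(x + y) + (y + z) = x + (z :: bit)"
  by (cases x; cases y; cases z) auto

text \<open>A spanning tree in the form of a path. Numbering by position turns the tree path between
  two vertices into an interval of indices.\<close>

locale hamiltonian_path =
  fixes G :: "('v, 'e) multigraph" and N :: nat and \<alpha> :: "nat \<Rightarrow> 'v" and a :: "nat \<Rightarrow> 'e"
  assumes finite_edges: "finite (edges G)"
    and ends_in_verts: "e \<in> edges G \<Longrightarrow> set_uprod (ends G e) \<subseteq> verts G"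
    and verts_eq: "verts G = \<alpha> ` {..N}"
    and inj_vertex: "inj_on \<alpha> {..N}"
    and inj_edge: "inj_on a {..<N}"
    and path_edge: "i < N \<Longrightarrow> a i \<in> edges G"
    and ends_path_edge: "i < N \<Longrightarrow> ends G (a i) = Upair (\<alpha> i) (\<alpha> (Suc i))"
begin

abbreviation cobasis :: "'e set" where
  "cobasis \<equiv> edges G - a ` {..<N}"

lemma boundary_segment:
  assumes "p \<le> q" "q \<le> N"
  shows "boundary G (\<Sum>i=p..<q. edge_chain (a i)) x = of_bool (x = \<alpha> p) + of_bool (x = \<alpha> q)"
  using assms
proof (induction q rule: dec_induct)
  case base
  then show ?case
    using boundary_zero [unfolded zero_fun_def] by simp
next
  case (step q)
  have last: "boundary G (edge_chain (a q)) x = of_bool (x = \<alpha> q) + of_bool (x = \<alpha> (Suc q))"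
    using step by (intro boundary_edge_chain finite_edges path_edge ends_path_edge) auto
  have "boundary G (\<Sum>i=p..<q. edge_chain (a i)) x = of_bool (x = \<alpha> p) + of_bool (x = \<alpha> q)"
    using step by simp
  then show ?case
    unfolding sum.atLeastLessThan_Suc [OF \<open>p \<le> q\<close>] boundary_add last by (simp only: bit_add_cancel_middle)
qed

lemma segment_apply:
  assumes "q \<le> N"
  shows "(\<Sum>i=p..<q. edge_chain (a i)) e = of_bool (e \<in> a ` {p..<q})"
proof (cases "e \<in> a ` {p..<q}")
  case True
  then obtain k where k: "k \<in> {p..<q}" "e = a k"
    by blast
  have "(\<Sum>i=p..<q. edge_chain (a i)) e = (\<Sum>i=p..<q. if i = k then 1 else 0)"
    unfolding sum_fun_apply edge_chain_def using k assms inj_edge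
    by (intro sum.cong) (auto simp: inj_on_def)
  with k True show ?thesis
    by simp
next
  case False
  then have "(\<Sum>i=p..<q. edge_chain (a i)) e = 0"
    unfolding sum_fun_apply edge_chain_def by (intro sum.neutral) auto
  with False show ?thesis
    by simp
qed

text \<open>A chord and the path segment between its ends form a cycle. Its values on the segment
  are recorded for the closure property of edge sets.\<close>

lemma fundamental_cycle_exists:
  assumes "b \<in> cobasis"
  shows "\<exists>c \<in> cycle_space G. (\<forall>b'\<in>cobasis. c b' = of_bool (b = b')) \<and>
    (\<forall>p q i. ends G b = Upair (\<alpha> p) (\<alpha> q) \<longrightarrow> p \<le> i \<longrightarrow> i < q \<longrightarrow> q \<le> N \<longrightarrow> c (a i) = 1)"
proof -
  obtain u v where uv: "ends G b = Upair u v"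
    by (cases "ends G b")
  then have "u \<in> \<alpha> ` {..N}" "v \<in> \<alpha> ` {..N}"
    using assms ends_in_verts [of b] by (simp_all add: verts_eq)
  then obtain p' q' where pq': "u = \<alpha> p'" "v = \<alpha> q'" "p' \<le> N" "q' \<le> N"
    by auto
  \<comment> \<open>The ends are unordered, so the smaller position becomes \<open>p\<close>; for a
    loop the segment is empty.\<close>
  obtain p q where pq: "ends G b = Upair (\<alpha> p) (\<alpha> q)" "p \<le> q" "q \<le> N"
  proof (cases "p' \<le> q'")
    case True
    with uv pq' show ?thesis
      by (intro that [of p' q']) auto
  next
    case False
    with uv pq' show ?thesis
      by (intro that [of q' p']) auto
  qed
  define c where "c = edge_chain b + (\<Sum>i=p..<q. edge_chain (a i))"
  have c: "c e = of_bool (e = b) + of_bool (e \<in> a ` {p..<q})" for e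
    unfolding c_def plus_fun_apply segment_apply [OF pq(3)] by (simp only: edge_chain_def)
  have "b \<in> edges G"
    using assms by simp
  then have bd: "boundary G c x = 0" for x
    unfolding c_def boundary_add boundary_segment [OF pq(2,3)]
    by (simp only: boundary_edge_chain [OF finite_edges _ pq(1)] bit_add_self)
  have "c e = 0" if "e \<notin> edges G" for e
  proof -
    have "e \<notin> a ` {p..<q}"
      using that pq(3) path_edge by auto
    then show ?thesis
      using that assms by (auto simp: c)
  qed
  with bd have cyc: "c \<in> cycle_space G"
    by (simp add: cycle_space_iff finite_edges)
  have cobasis: "c b' = of_bool (b = b')" if "b' \<in> cobasis" for b'
  proof -
    have "b' \<notin> a ` {p..<q}"
      using that pq(3) by auto
    then show ?thesis
      by (auto simp: c)
  qed
  have one: "c (a i) = 1" if "ends G b = Upair (\<alpha> p') (\<alpha> q')" "p' \<le> i" "i < q'" "q' \<le> N" for p' q' i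
  proof -
    have "p' \<le> N" "i < N"
      using that(2-4) by simp_all
    have "p = p' \<and> q = q' \<or> p = q' \<and> q = p'"
      using that(1) pq \<open>p' \<le> N\<close> that(4) by (auto simp: inj_on_eq_iff [OF inj_vertex])
    \<comment> \<open>The reversed case is impossible, since \<open>p \<le> q\<close> but
      \<open>p' < q'\<close>.\<close>
    then have "i \<in> {p..<q}"
      using that(2,3) pq(2) by (elim disjE) simp_all
    then have "a i \<in> a ` {p..<q}"
      by (rule imageI)
    moreover have "a i \<noteq> b"
    proof
      assume "a i = b"
      then have "b \<in> a ` {..<N}"
        using \<open>i < N\<close> by (intro image_eqI [of _ _ i]) simp_all
      with assms show False
        by simp
    qed
    ultimately show ?thesis
      unfolding c by simp
  qed
  show ?thesis
    by (intro bexI [of _ c] conjI ballI allI impI cyc) (fact cobasis, rule one)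
qed

text \<open>Induction along the path: besides \<open>a k\<close>, the only path edge at
  \<open>\<alpha> k\<close> is the preceding one, whose coefficient is already 0, so the vanishing
  boundary at \<open>\<alpha> k\<close> forces \<open>c (a k) = 0\<close>.\<close>

lemma cycle_eq_0:
  assumes c: "c \<in> cycle_space G" and zero: "\<And>b. b \<in> cobasis \<Longrightarrow> c b = 0"
  shows "c = 0"
proof -
  have path: "c (a k) = 0" if "k < N" for k
    using that
  proof (induction k rule: less_induct)
    case (less k)
    have "boundary G c (\<alpha> k) =
        (\<Sum>e\<in>a ` {..<N}. if proper_uprod (ends G e) \<and> \<alpha> k \<in> set_uprod (ends G e) then c e else 0)"
      unfolding boundary_def using path_edge zero
      by (intro sum.mono_neutral_right finite_edges) auto
    also have "\<dots> = (\<Sum>i<N. if proper_uprod (ends G (a i)) \<and> \<alpha> k \<in> set_uprod (ends G (a i)) then c (a i) else 0)"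
      by (simp add: sum.reindex inj_edge)
    also have "\<dots> = (\<Sum>i<N. if i = k then c (a k) else 0)"
    proof (rule sum.cong)
      fix i assume i: "i \<in> {..<N}"
      have "\<alpha> k = \<alpha> i \<longleftrightarrow> k = i" "\<alpha> k = \<alpha> (Suc i) \<longleftrightarrow> k = Suc i" "\<alpha> i \<noteq> \<alpha> (Suc i)"
        using inj_vertex i less.prems by (auto simp: inj_on_eq_iff)
      then show "(if proper_uprod (ends G (a i)) \<and> \<alpha> k \<in> set_uprod (ends G (a i)) then c (a i) else 0)
          = (if i = k then c (a k) else 0)"
        using i less by (auto simp: ends_path_edge)
    qed simp
    also have "\<dots> = c (a k)"
      using less.prems by simp
    finally show ?case
      using c less.prems by (simp add: cycle_space_iff finite_edges verts_eq)
  qed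
  show ?thesis
  proof
    fix e
    show "c e = 0 e"
      using c zero path by (cases "e \<in> edges G") (auto simp: cycle_space_iff finite_edges)
  qed
qed

lemma obtain_cycle_basis:
  obtains C where "cycle_basis G cobasis C"
    and "\<And>b p q i. b \<in> cobasis \<Longrightarrow> ends G b = Upair (\<alpha> p) (\<alpha> q) \<Longrightarrow> p \<le> i \<Longrightarrow> i < q \<Longrightarrow> q \<le> N \<Longrightarrow>
      C b (a i) = 1"
proof -
  have "\<forall>b\<in>cobasis. \<exists>c. c \<in> cycle_space G \<and> (\<forall>b'\<in>cobasis. c b' = of_bool (b = b')) \<and>
    (\<forall>p q i. ends G b = Upair (\<alpha> p) (\<alpha> q) \<longrightarrow> p \<le> i \<longrightarrow> i < q \<longrightarrow> q \<le> N \<longrightarrow> c (a i) = 1)"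
    using fundamental_cycle_exists by blast
  from bchoice [OF this] obtain C where C: "\<And>b. b \<in> cobasis \<Longrightarrow> C b \<in> cycle_space G"
    "\<And>b b'. b \<in> cobasis \<Longrightarrow> b' \<in> cobasis \<Longrightarrow> C b b' = of_bool (b = b')"
    "\<And>b p q i. b \<in> cobasis \<Longrightarrow> ends G b = Upair (\<alpha> p) (\<alpha> q) \<Longrightarrow> p \<le> i \<Longrightarrow> i < q \<Longrightarrow> q \<le> N \<Longrightarrow>
      C b (a i) = 1"
    by blast
  have "cycle_basis G cobasis C"
    by (rule cycle_basis.intro) (fact finite_edges, fact Diff_subset, fact C(1), fact C(2), rule cycle_eq_0)
  then show ?thesis
    using C(3) by (rule that)
qed

lemma cycle_number_eq: "cycle_number G = card cobasis"
proof (rule obtain_cycle_basis)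
  fix C assume "cycle_basis G cobasis C"
  then show ?thesis
    by (rule cycle_basis.cycle_number_eq)
qed

lemma cycle_number_subgraph_le:
  assumes "F \<subseteq> edges G"
  shows "cycle_number (edge_subgraph G F) \<le> card (F - a ` {..<N})"
proof (rule obtain_cycle_basis)
  fix C assume "cycle_basis G cobasis C"
  from cycle_basis.cycle_number_subgraph_le [OF this assms] show ?thesis
    using assms by (metis Int_Diff inf.absorb1)
qed

text \<open>Equality in \<open>cycle_number_subgraph_le\<close> puts the whole fundamental cycle of
  each chord of \<open>F\<close> into \<open>F\<close>.\<close>

lemma segment_in_subgraph:
  assumes "F \<subseteq> edges G" "cycle_number (edge_subgraph G F) = card (F - a ` {..<N})"
    and "b \<in> F" "b \<notin> a ` {..<N}" "ends G b = Upair (\<alpha> p) (\<alpha> q)" "p \<le> i" "i < q" "q \<le> N"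
  shows "a i \<in> F"
proof (rule obtain_cycle_basis)
  fix C
  assume C: "cycle_basis G cobasis C" and one: "\<And>b p q i. b \<in> cobasis \<Longrightarrow>
    ends G b = Upair (\<alpha> p) (\<alpha> q) \<Longrightarrow> p \<le> i \<Longrightarrow> i < q \<Longrightarrow> q \<le> N \<Longrightarrow> C b (a i) = 1"
  have eq: "F \<inter> cobasis = F - a ` {..<N}"
    using assms(1) by auto
  have "C b (a i) = 1"
    using assms by (intro one [of b p q i]) auto
  then show ?thesis
    using assms(2-4) eq by (intro cycle_basis.cycle_in_subgraph [OF C assms(1), of b]) auto
qed

end

subsection \<open>Unions of two Hamiltonian paths\<close>

text \<open>Even edges form the first path and odd edges the second, so the paths are edge-disjoint
  even where they run in parallel.\<close>

definition double_path :: "nat \<Rightarrow> (nat \<Rightarrow> nat) \<Rightarrow> (nat, nat) multigraph" where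
  "double_path N \<pi> = \<lparr>verts = {..N}, edges = {..<2 * N},
     ends = (\<lambda>e. if even e then Upair (e div 2) (Suc (e div 2)) else Upair (\<pi> (e div 2)) (\<pi> (Suc (e div 2))))\<rparr>"

lemma verts_double_path [simp]: "verts (double_path N \<pi>) = {..N}"
  and edges_double_path [simp]: "edges (double_path N \<pi>) = {..<2 * N}"
  and ends_double_path_even [simp]: "ends (double_path N \<pi>) (2 * i) = Upair i (Suc i)"
  and ends_double_path_odd [simp]: "ends (double_path N \<pi>) (Suc (2 * i)) = Upair (\<pi> i) (\<pi> (Suc i))"
  by (simp_all add: double_path_def)

lemma edge_cases:
  assumes "e < 2 * N"
  obtains i where "i < N" "e = 2 * i" | i where "i < N" "e = Suc (2 * i)"
  using assms by (cases "even e") (auto elim!: evenE oddE)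

locale path_permutation =
  fixes N :: nat and \<pi> :: "nat \<Rightarrow> nat"
  assumes bij: "bij_betw \<pi> {..N} {..N}"
begin

abbreviation G :: "(nat, nat) multigraph" where
  "G \<equiv> double_path N \<pi>"

lemma perm_le: "i \<le> N \<Longrightarrow> \<pi> i \<le> N"
  using bij by (auto simp: bij_betw_def)

lemma perm_eq_iff: "i \<le> N \<Longrightarrow> j \<le> N \<Longrightarrow> \<pi> i = \<pi> j \<longleftrightarrow> i = j"
  using bij by (auto simp: bij_betw_def inj_on_eq_iff)

lemma perm_surj: "v \<le> N \<Longrightarrow> \<exists>p\<le>N. \<pi> p = v"
  using equalityD2 [OF bij_betw_imp_surj_on [OF bij]] by (auto dest!: subsetD)

lemma ends_subset: "e \<in> edges G \<Longrightarrow> set_uprod (ends G e) \<subseteq> verts G"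
  by (auto elim!: edge_cases simp: perm_le)

lemma finite_multigraph: "finite_multigraph G"
  using ends_subset by (simp add: finite_multigraph_def)

lemma in_phi4: "in_phi4 G"
  unfolding in_phi4_def
proof
  fix v assume "v \<in> verts G"
  then obtain p where p: "p \<le> N" "\<pi> p = v"
    using perm_surj by auto
  have no_loop: "{e \<in> edges G. ends G e = Upair v v} = {}"
    by (auto elim!: edge_cases simp: perm_eq_iff)
  \<comment> \<open>Each path has at most two edges at \<open>v\<close>, whose positions on the
    paths are \<open>v\<close> and \<open>p\<close>. At position 0 the truncated predecessor only
    repeats an edge.\<close>
  have "{e \<in> edges G. v \<in> set_uprod (ends G e)} \<subseteq> {2 * v, 2 * (v - 1), Suc (2 * p), Suc (2 * (p - 1))}"
    using p by (auto elim!: edge_cases simp: perm_eq_iff)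
  then have "card {e \<in> edges G. v \<in> set_uprod (ends G e)} \<le>
      card {2 * v, 2 * (v - 1), Suc (2 * p), Suc (2 * (p - 1))}"
    by (intro card_mono) simp_all
  also have "\<dots> \<le> 4"
    using card_length [of "[2 * v, 2 * (v - 1), Suc (2 * p), Suc (2 * (p - 1))]"] by simp
  finally show "degree G v \<le> 4"
    by (simp only: degree_def no_loop card.empty add_0_right)
qed

sublocale even_path: hamiltonian_path G N id "\<lambda>i. 2 * i"
  by (rule hamiltonian_path.intro) (use ends_subset in \<open>auto simp: inj_on_def\<close>)

sublocale odd_path: hamiltonian_path G N \<pi> "\<lambda>i. Suc (2 * i)"
  by (rule hamiltonian_path.intro) (use ends_subset bij in \<open>auto simp: inj_on_def bij_betw_def\<close>)

lemma Upair_eq_if: "{u, v} = {x, y} \<Longrightarrow> Upair u v = Upair x y"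
  by (auto simp: doubleton_eq_iff)

text \<open>
  If \<open>2 * h = card F\<close> then both paths are forests spanning the same components of \<open>F\<close>, so \<open>F\<close> contains
  the fundamental cycle of each of its edges with respect to the other path.
\<close>

lemma primitive_divergentI:
  assumes closed: "\<And>F. F \<noteq> {} \<Longrightarrow> F \<subseteq> {..<2 * N} \<Longrightarrow>
      (\<And>j p q i. j < N \<Longrightarrow> Suc (2 * j) \<in> F \<Longrightarrow> {\<pi> j, \<pi> (Suc j)} = {p, q} \<Longrightarrow> p \<le> i \<Longrightarrow> i < q \<Longrightarrow> 2 * i \<in> F) \<Longrightarrow>
      (\<And>i p q j. i < N \<Longrightarrow> 2 * i \<in> F \<Longrightarrow> {i, Suc i} = {\<pi> p, \<pi> q} \<Longrightarrow> p \<le> j \<Longrightarrow> j < q \<Longrightarrow> q \<le> N \<Longrightarrow>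
        Suc (2 * j) \<in> F) \<Longrightarrow>
      \<forall>i<N. 2 * i \<in> F"
  shows "primitive_divergent G"
proof -
  let ?E = "(\<lambda>i::nat. 2 * i) ` {..<N}" and ?O = "(\<lambda>i::nat. Suc (2 * i)) ` {..<N}"
  have parts: "{..<2 * N} = ?E \<union> ?O"
    by (auto elim: edge_cases)
  have disj: "?E \<inter> ?O = {}"
    by (auto simp: image_iff) presburger
  have card: "card ?E = N" "card ?O = N"
    by (simp_all add: card_image inj_on_def)
  have "edges G - ?E = ?O"
    using disj unfolding edges_double_path parts by blast
  then have total: "card (edges G) = 2 * cycle_number G"
    using even_path.cycle_number_eq card by simp
  have "2 * cycle_number (edge_subgraph G F) < card F" if F: "F \<noteq> {}" "F \<subset> edges G" for F
  proof (rule ccontr)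
    assume le: "\<not> 2 * cycle_number (edge_subgraph G F) < card F"
    let ?h = "cycle_number (edge_subgraph G F)"
    have sub: "F \<subseteq> edges G" "F \<subseteq> {..<2 * N}" and fin: "finite F"
      using F by (auto intro: finite_subset)
    have "card F = card (F - ?E) + card (F - ?O)"
    proof -
      have "F = (F - ?E) \<union> (F - ?O)"
        using disj by blast
      moreover have "(F - ?E) \<inter> (F - ?O) = {}"
        using sub(2) unfolding parts by blast
      ultimately show ?thesis
        using fin by (metis card_Un_disjoint finite_Diff)
    qed
    \<comment> \<open>The edges off the two paths together make up \<open>F\<close>, and
      \<open>card F \<le> 2 * ?h\<close>; so both bounds are attained.\<close>
    moreover have "?h \<le> card (F - ?E)" "?h \<le> card (F - ?O)"
      using even_path.cycle_number_subgraph_le odd_path.cycle_number_subgraph_le sub(1) by blast+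
    ultimately have h: "?h = card (F - ?E)" "?h = card (F - ?O)" "card F = 2 * card (F - ?O)"
      using le by linarith+
    have "\<forall>i<N. 2 * i \<in> F"
    proof (rule closed [OF F(1) sub(2)])
      fix j p q i
      assume *: "j < N" "Suc (2 * j) \<in> F" "{\<pi> j, \<pi> (Suc j)} = {p, q}" "p \<le> i" "i < q"
      then have "q \<le> N"
        using perm_le [of j] perm_le [of "Suc j"] by (auto simp: doubleton_eq_iff)
      moreover have "Suc (2 * j) \<notin> ?E"
        using disj \<open>j < N\<close> by blast
      moreover have "ends G (Suc (2 * j)) = Upair (id p) (id q)"
        using Upair_eq_if [OF *(3)] by simp
      ultimately show "2 * i \<in> F"
        using even_path.segment_in_subgraph [OF sub(1) h(1) *(2)] *(4,5) by blast
    next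
      fix i p q j
      assume *: "i < N" "2 * i \<in> F" "{i, Suc i} = {\<pi> p, \<pi> q}" "p \<le> j" "j < q" "q \<le> N"
      moreover have "2 * i \<notin> ?O"
        using disj \<open>i < N\<close> by blast
      moreover have "ends G (2 * i) = Upair (\<pi> p) (\<pi> q)"
        using Upair_eq_if [OF *(3)] by simp
      ultimately show "Suc (2 * j) \<in> F"
        using odd_path.segment_in_subgraph [OF sub(1) h(2) *(2)] by blast
    qed
    \<comment> \<open>Both paths have equally many edges in \<open>F\<close>, so containing the
      first path entirely gives \<open>2 * N\<close> edges.\<close>
    then have "F - ?O = ?E"
      using sub(2) disj unfolding parts by blast
    then have "card F = 2 * N"
      using h(3) card by simp
    then have "F = edges G"
      using sub(2) by (intro card_subset_eq) simp_all
    with F(2) show False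
      by simp
  qed
  with total show ?thesis
    by (simp add: primitive_divergent_def)
qed

end

subsection \<open>Minors\<close>

lemma has_minor_edge_subgraph:
  assumes "has_minor G H" "finite (edges H)" "F \<subseteq> edges H"
  shows "has_minor G (edge_subgraph H F)"
proof -
  have "has_minor G (edge_subgraph H (edges H - D))" if "finite D" "D \<subseteq> edges H" for D
    using that
  proof (induction D)
    case empty
    have "edge_subgraph H (edges H - {}) = H"
      by (simp add: edge_subgraph_def)
    with assms(1) show ?case
      by simp
  next
    case (insert e D)
    then have "has_minor G (delete_edge (edge_subgraph H (edges H - D)) e)"
      by (intro has_minor.delete) (auto simp: edge_subgraph_def)
    moreover have "delete_edge (edge_subgraph H (edges H - D)) e = edge_subgraph H (edges H - insert e D)"
      by (auto simp: delete_edge_def edge_subgraph_def)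
    ultimately show ?case
      by simp
  qed
  from this [of "edges H - F"] assms(2,3) show ?thesis
    by (simp add: double_diff)
qed

context path_permutation
begin

text \<open>
  \<open>\<phi>\<close> maps each vertex to its branch set and \<open>s\<close> maps a branch set, which is an interval, to its least vertex.
\<close>

lemma occurs_as_minor_ofI:
  fixes \<phi> :: "nat \<Rightarrow> 'v" and s :: "'v \<Rightarrow> nat" and \<chi> :: "'f \<Rightarrow> nat" and K :: "('v, 'f) multigraph"
  assumes s_le: "\<And>v. s (\<phi> v) \<le> v" and \<phi>_s: "\<And>v. \<phi> (s (\<phi> v)) = \<phi> v"
    and step: "\<And>v. \<phi> (Suc v) \<noteq> \<phi> v \<Longrightarrow> s (\<phi> (Suc v)) = Suc v"
    and verts: "verts K = \<phi> ` {..N}"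
    and inj: "inj_on \<chi> (edges K)" and \<chi>_less: "\<And>f. f \<in> edges K \<Longrightarrow> \<chi> f < N"
    and ends: "\<And>f. f \<in> edges K \<Longrightarrow> ends K f = Upair (\<phi> (\<pi> (\<chi> f))) (\<phi> (\<pi> (Suc (\<chi> f))))"
  shows "occurs_as_minor_of K G"
proof -
  \<comment> \<open>State after \<open>k\<close> steps: vertices up to \<open>k\<close> are merged
    into the least vertices of their branch sets, larger ones are untouched.\<close>
  define r where "r k v = (if v \<le> k then s (\<phi> v) else v)" for k v
  define H where "H k = \<lparr>verts = r k ` {..N}, edges = {..<2 * N} - {2 * i | i. i < k \<and> \<phi> (Suc i) = \<phi> i},
    ends = (\<lambda>e. map_uprod (r k) (ends G e))\<rparr>" for k
  have minor: "has_minor G (H k)" if "k \<le> N" for k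
    using that
  proof (induction k)
    case 0
    have "r 0 = id"
      using s_le [of 0] by (auto simp: r_def fun_eq_iff)
    then have "H 0 = G"
      by (simp add: H_def uprod.map_id0 double_path_def)
    then show ?case
      by (simp add: has_minor.refl)
  next
    case (Suc k)
    show ?case
    proof (cases "\<phi> (Suc k) = \<phi> k")
      case True
      let ?r = "\<lambda>x. if x = Suc k then s (\<phi> k) else x"
      have r: "?r \<circ> r k = r (Suc k)"
      proof
        fix v
        show "(?r \<circ> r k) v = r (Suc k) v"
          using True s_le [of v] by (auto simp: r_def le_Suc_eq)
      qed
      have edge: "2 * k \<in> edges (H k)"
        using Suc.prems by (auto simp: H_def)
      have "ends (H k) (2 * k) = Upair (s (\<phi> k)) (Suc k)"
        by (simp add: H_def r_def)
      with edge Suc have "has_minor G (contract_edge (H k) (2 * k) (s (\<phi> k)) (Suc k))"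
        by (intro has_minor.contract) auto
      moreover have "contract_edge (H k) (2 * k) (s (\<phi> k)) (Suc k) = H (Suc k)"
      proof -
        have "?r ` r k ` {..N} = r (Suc k) ` {..N}"
          unfolding image_comp r ..
        moreover have "map_uprod ?r (map_uprod (r k) e) = map_uprod (r (Suc k)) e" for e
          unfolding uprod.map_comp r ..
        moreover have "{2 * i |i. i < Suc k \<and> \<phi> (Suc i) = \<phi> i} =
            insert (2 * k) {2 * i |i. i < k \<and> \<phi> (Suc i) = \<phi> i}"
          using True by (auto simp: less_Suc_eq)
        ultimately show ?thesis
          by (simp add: contract_edge_def H_def Let_def) blast
      qed
      ultimately show ?thesis
        by simp
    next
      case False
      \<comment> \<open>A new branch set starts at \<open>Suc k\<close>, which is its own least
        vertex; nothing is contracted.\<close>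
      have "r (Suc k) = r k"
        using step [OF False] by (auto simp: r_def fun_eq_iff le_Suc_eq)
      moreover have "{2 * i |i. i < Suc k \<and> \<phi> (Suc i) = \<phi> i} = {2 * i |i. i < k \<and> \<phi> (Suc i) = \<phi> i}"
        using False less_Suc_eq by auto
      ultimately have "H (Suc k) = H k"
        by (simp add: H_def)
      with Suc show ?thesis
        by simp
    qed
  qed
  \<comment> \<open>Edges of \<open>K\<close> are represented by edges of the second path, which are
    odd and hence never contracted.\<close>
  define \<chi>' where "\<chi>' f = Suc (2 * \<chi> f)" for f
  have inj': "inj_on \<chi>' (edges K)"
    using inj by (auto simp: \<chi>'_def inj_on_def)
  have "\<chi>' f \<in> edges (H N)" if "f \<in> edges K" for f
  proof -
    have "Suc (2 * \<chi> f) < 2 * N" "\<And>i. Suc (2 * \<chi> f) \<noteq> 2 * i"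
      using \<chi>_less [OF that] by presburger+
    then show ?thesis
      by (auto simp: H_def \<chi>'_def)
  qed
  then have F: "\<chi>' ` edges K \<subseteq> edges (H N)"
    by blast
  let ?H = "edge_subgraph (H N) (\<chi>' ` edges K)"
  have "has_minor G ?H"
    using F by (intro has_minor_edge_subgraph minor) (auto simp: H_def)
  moreover have "multigraph_iso ?H K"
    unfolding multigraph_iso_def
  proof (intro exI conjI)
    have "verts ?H = (\<lambda>v. s (\<phi> v)) ` {..N}"
      by (simp add: edge_subgraph_def H_def r_def)
    then show "bij_betw \<phi> (verts ?H) (verts K)"
      unfolding verts bij_betw_def by (auto simp: inj_on_def \<phi>_s image_image)
    have "bij_betw \<chi>' (edges K) (edges ?H)"
      using inj' by (simp add: bij_betw_def edge_subgraph_def)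
    then show "bij_betw (the_inv_into (edges K) \<chi>') (edges ?H) (edges K)"
      by (rule bij_betw_the_inv_into)
    show "\<forall>e\<in>edges ?H. ends K (the_inv_into (edges K) \<chi>' e) = map_uprod \<phi> (ends ?H e)"
    proof
      fix e assume "e \<in> edges ?H"
      then obtain f where f: "f \<in> edges K" "e = \<chi>' f"
        by (auto simp: edge_subgraph_def)
      have "\<phi> (r N v) = \<phi> v" for v
        by (simp add: r_def \<phi>_s)
      then have "map_uprod \<phi> (ends ?H e) = ends K f"
        using f by (simp add: ends edge_subgraph_def H_def \<chi>'_def)
      then show "ends K (the_inv_into (edges K) \<chi>' e) = map_uprod \<phi> (ends ?H e)"
        using f by (simp add: the_inv_into_f_f [OF inj'])
    qed
  qed
  ultimately show ?thesis
    by (auto simp: occurs_as_minor_of_def)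
qed

end

subsection \<open>The grid\<close>

text \<open>There are \<open>n\<close> inner rows between a first and a last one, and
  \<open>m\<close> columns, so that each pair \<open>(a, b)\<close> of rows has its own column code
  \<open>a * R + b\<close>. Vertex \<open>i * m + j\<close> is in row \<open>i\<close> and column
  \<open>j\<close>.\<close>

locale complete_graph_grid =
  fixes n R m N :: nat
  assumes n: "n \<ge> 2" and R: "R = n + 2" and m: "m = R * R" and N: "Suc N = R * m"
begin

text \<open>\<open>row c k\<close> is the row visited at step \<open>k\<close> of column code
  \<open>c = a * R + b\<close>. Exchanging \<open>b\<close> with \<open>Suc a\<close> makes row
  \<open>b\<close> follow row \<open>a\<close>.\<close>

definition row :: "nat \<Rightarrow> nat \<Rightarrow> nat" where
  "row c = (if 0 < c div R \<and> c div R < c mod R \<and> c mod R \<le> n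
    then transpose (Suc (c div R)) (c mod R) else id)"

text \<open>Column codes count columns from the right, whence
  \<open>m - 1 - p div R\<close>.\<close>

definition perm :: "nat \<Rightarrow> nat" where
  "perm p = row (p div R) (p mod R) * m + (m - 1 - p div R)"

lemma R_pos: "0 < R" and m_ge: "m \<ge> 16"
proof -
  show "0 < R"
    by (simp add: R)
  have "4 * 4 \<le> R * R"
    using n by (intro mult_le_mono) (simp_all add: R)
  then show "m \<ge> 16"
    by (simp add: m)
qed

lemma row_less: "k < R \<Longrightarrow> row c k < R"
  unfolding row_def by (auto simp: R transpose_def)

lemma row_eq_iff: "row c k = row c l \<longleftrightarrow> k = l"
  by (auto simp: row_def transpose_eq_iff)

text \<open>Exchanged rows lie between 2 and \<open>n\<close>. Hence every change of column goes
  from the last row to the first.\<close>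

lemma row_first: "row c 0 = 0"
  by (auto simp: row_def transpose_def)

lemma row_last: "row c (Suc n) = Suc n"
  by (auto simp: row_def transpose_def)

lemma perm_eq: "k < R \<Longrightarrow> perm (c * R + k) = row c k * m + (m - 1 - c)"
  by (simp add: perm_def)

lemma perm_div: "perm p div m = row (p div R) (p mod R)"
  and perm_mod: "perm p mod m = m - 1 - p div R"
  using m_ge by (simp_all add: perm_def)

lemma column_less: "p \<le> N \<Longrightarrow> p div R < m"
  using N by (intro less_mult_imp_div_less) (simp add: mult.commute)

lemma grid_le: "i < R \<Longrightarrow> j < m \<Longrightarrow> i * m + j \<le> N"
proof -
  assume "i < R" "j < m"
  then have "i * m + j < Suc i * m" "Suc i * m \<le> R * m"
    by (simp, intro mult_le_mono1) simp
  then show ?thesis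
    using N by linarith
qed

lemma bij_perm: "bij_betw perm {..N} {..N}"
proof -
  have "inj_on perm {..N}"
  proof (rule inj_onI)
    fix p q assume "p \<in> {..N}" "q \<in> {..N}" and eq: "perm p = perm q"
    then have "p div R < m" "q div R < m"
      using column_less by auto
    moreover have "m - 1 - p div R = m - 1 - q div R"
      using eq perm_mod by metis
    ultimately have "p div R = q div R"
      by linarith
    moreover from this have "p mod R = q mod R"
      using eq perm_div row_eq_iff by metis
    ultimately show "p = q"
      by (metis div_mult_mod_eq)
  qed
  moreover have "perm ` {..N} \<subseteq> {..N}"
    using m_ge R_pos by (auto simp: perm_def intro!: grid_le row_less)
  ultimately show ?thesis
    by (simp add: bij_betw_def endo_inj_surj)
qed

sublocale path_permutation N perm
  by (rule path_permutation.intro) (rule bij_perm)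

text \<open>Within a column \<open>row\<close> is injective; a change of column leads from row
  \<open>Suc n\<close> to row 0.\<close>

lemma perm_Suc_row:
  assumes "j < N"
  shows "perm j div m \<noteq> perm (Suc j) div m"
proof (cases "Suc (j mod R) = R")
  case True
  then have "Suc j div R = Suc (j div R)" "Suc j mod R = 0" "j mod R = Suc n"
    by (simp_all add: div_Suc mod_Suc R)
  then show ?thesis
    by (simp add: perm_div row_first row_last)
next
  case False
  then have "Suc j div R = j div R" "Suc j mod R = Suc (j mod R)"
    by (simp_all add: div_Suc mod_Suc)
  then show ?thesis
    by (simp add: perm_div row_eq_iff)
qed

text \<open>
  Every step of the second path changes the row, hence spans an edge of the first path between consecutive rows.
  The ends of that edge lie in the first and in the last column visited by the second path, so all columns
  in between are traversed; the two column changes at \<open>R\<close> and \<open>(m - 1) * R\<close> then span the whole first path.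
\<close>

lemma primitive_divergent: "primitive_divergent G"
proof (rule primitive_divergentI, intro allI impI)
  fix F i0
  assume nonempty: "F \<noteq> {}" and sub: "F \<subseteq> {..<2 * N}"
    and even: "\<And>j p q i. j < N \<Longrightarrow> Suc (2 * j) \<in> F \<Longrightarrow> {perm j, perm (Suc j)} = {p, q} \<Longrightarrow> p \<le> i \<Longrightarrow> i < q \<Longrightarrow>
      2 * i \<in> F"
    and odd: "\<And>i p q j. i < N \<Longrightarrow> 2 * i \<in> F \<Longrightarrow> {i, Suc i} = {perm p, perm q} \<Longrightarrow> p \<le> j \<Longrightarrow> j < q \<Longrightarrow> q \<le> N \<Longrightarrow>
      Suc (2 * j) \<in> F"
    and "i0 < N"
  obtain e where "e \<in> F" "e < 2 * N"
    using nonempty sub by blast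
  \<comment> \<open>\<open>F\<close> contains an odd edge, because an even one brings in a nonempty
    segment of the second path.\<close>
  obtain j where j: "j < N" "Suc (2 * j) \<in> F"
    using \<open>e < 2 * N\<close>
  proof (cases rule: edge_cases)
    case (1 i)
    obtain p q where pq: "p \<le> N" "q \<le> N" "perm p = i" "perm q = Suc i"
      using perm_surj [of i] perm_surj [of "Suc i"] 1 by auto
    then have "p \<noteq> q" "{i, Suc i} = {perm (min p q), perm (max p q)}"
      by (auto simp: min_def max_def)
    then have "Suc (2 * min p q) \<in> F" "min p q < N"
      using odd [of i "min p q" "max p q" "min p q"] pq 1 \<open>e \<in> F\<close> by auto
    then show ?thesis
      by (intro that)
  next
    case (2 i)
    with \<open>e \<in> F\<close> show ?thesis
      by (intro that [of i]) simp_all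
  qed
  obtain p q where pq: "{perm j, perm (Suc j)} = {p, q}" "p div m < q div m" "q \<le> N"
  proof (cases "perm j div m < perm (Suc j) div m")
    case True
    with j perm_le show ?thesis
      by (intro that [of "perm j" "perm (Suc j)"]) auto
  next
    case False
    with j perm_le perm_Suc_row [OF j(1)] show ?thesis
      by (intro that [of "perm (Suc j)" "perm j"]) auto
  qed
  \<comment> \<open>The last vertex in the row of \<open>p\<close>; its successor starts the next
    row.\<close>
  define i where "i = p div m * m + (m - 1)"
  have "p \<le> i"
    using div_mult_mod_eq [of p m] mod_less_divisor [of m p] m_ge unfolding i_def by linarith
  have Suc_i: "Suc i = Suc (p div m) * m"
    using m_ge by (simp add: i_def)
  also have "\<dots> \<le> q div m * m"
    using pq(2) by (intro mult_le_mono1) simp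
  also have "\<dots> \<le> q"
    by simp
  finally have "Suc i \<le> q" .
  then have "2 * i \<in> F" "Suc i \<le> N"
    using even [OF j pq(1) \<open>p \<le> i\<close>] pq(3) by simp_all
  obtain P where P: "P \<le> N" "perm P = i"
    using perm_surj [of i] \<open>Suc i \<le> N\<close> by auto
  obtain Q where Q: "Q \<le> N" "perm Q = Suc i"
    using perm_surj [of "Suc i"] \<open>Suc i \<le> N\<close> by auto
  \<comment> \<open>Vertex \<open>i\<close> is in the rightmost column, visited first, and
    \<open>Suc i\<close> in the leftmost, visited last.\<close>
  have "m - 1 - P div R = m - 1"
    using perm_mod [of P] m_ge unfolding P(2) i_def mod_mult_self3 by simp
  then have "P div R = 0"
    using column_less [OF P(1)] m_ge by linarith
  then have "P \<le> R - 1"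
    using R_pos by (simp add: div_eq_0_iff)
  have "m - 1 - Q div R = 0"
    using perm_mod [of Q] unfolding Q(2) Suc_i by simp
  then have "m - 1 \<le> Q div R"
    by simp
  then have "(m - 1) * R \<le> Q"
    using R_pos by (simp add: less_eq_div_iff_mult_less_eq)
  have middle: "Suc (2 * j) \<in> F" if "R - 1 \<le> j" "j < (m - 1) * R" for j
    using odd [of i P Q j] \<open>2 * i \<in> F\<close> \<open>Suc i \<le> N\<close> \<open>P \<le> R - 1\<close> \<open>(m - 1) * R \<le> Q\<close> P Q that by simp
  have "1 * R \<le> (m - 1) * R"
    using m_ge by (intro mult_le_mono1) linarith
  then have R_le: "R \<le> (m - 1) * R"
    by simp
  show "2 * i0 \<in> F"
  proof (cases "i0 < m - 2")
    case True
    \<comment> \<open>The last change of column goes from row \<open>Suc n\<close>, column 1, to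
      vertex 0 and spans all smaller \<open>i0\<close>.\<close>
    have sub_eq: "(m - 2) * R + Suc n = (m - 1) * R - 1"
    proof -
      have "m - 1 = Suc (m - 2)"
        using m_ge by simp
      then have "(m - 1) * R = R + (m - 2) * R"
        by simp
      then show ?thesis
        using R by linarith
    qed
    have "(m - 1) * R \<le> N"
      using \<open>(m - 1) * R \<le> Q\<close> Q(1) by simp
    have ge: "R - 1 \<le> (m - 1) * R - 1"
      using R_le by (rule diff_le_mono)
    have pos: "0 < (m - 1) * R"
      using R_le R_pos by (rule less_le_trans [rotated])
    have "perm ((m - 1) * R - 1) = Suc n * m + 1"
    proof -
      have "Suc n < R" "m - 1 - (m - 2) = 1"
        using R m_ge by linarith+
      then show ?thesis
        unfolding sub_eq [symmetric] by (simp only: perm_eq row_last)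
    qed
    moreover have "perm ((m - 1) * R) = 0"
      using perm_eq [of 0 "m - 1"] R_pos by (simp add: row_first)
    ultimately have "{perm ((m - 1) * R - 1), perm (Suc ((m - 1) * R - 1))} = {0, Suc n * m + 1}"
      using pos by auto
    moreover have "i0 < Suc n * m + 1"
      using True by simp
    moreover have "(m - 1) * R - 1 < N" "(m - 1) * R - 1 < (m - 1) * R"
      using \<open>(m - 1) * R \<le> N\<close> pos by linarith+
    moreover have "Suc (2 * ((m - 1) * R - 1)) \<in> F"
      using ge \<open>(m - 1) * R - 1 < (m - 1) * R\<close> by (rule middle)
    ultimately show ?thesis
      using even [of "(m - 1) * R - 1" 0 "Suc n * m + 1" i0] by blast
  next
    case False
    \<comment> \<open>The first change of column goes from the last vertex \<open>N\<close> to
      \<open>m - 2\<close> and spans the remaining \<open>i0\<close>.\<close>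
    have "R - 1 < (m - 1) * R"
      using R_le R_pos by linarith
    have "perm (R - 1) = N"
    proof -
      have "perm (R - 1) = Suc n * m + (m - 1)"
      proof -
        have "R - 1 = 0 * R + Suc n" "Suc n < R"
          using R by simp_all
        then show ?thesis
          by (simp only: perm_eq row_last diff_zero)
      qed
      also have "Suc \<dots> = R * m"
        using m_ge by (simp add: R)
      finally show ?thesis
        using N by simp
    qed
    moreover have "perm R = m - 2"
      using perm_eq [of 0 1] R_pos by (simp add: row_first)
    ultimately have "{perm (R - 1), perm (Suc (R - 1))} = {m - 2, N}"
      using R_pos by auto
    moreover have "R - 1 < N"
      using \<open>R - 1 < (m - 1) * R\<close> \<open>(m - 1) * R \<le> Q\<close> Q(1) by simp
    ultimately show ?thesis
      using even [of "R - 1" "m - 2" N i0] middle [OF order_refl \<open>R - 1 < (m - 1) * R\<close>] False \<open>i0 < N\<close>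
      by simp
  qed
qed

text \<open>Clamping to \<open>{1..n}\<close> joins the first and the last row to their
  neighbours.\<close>

definition branch :: "nat \<Rightarrow> nat" where
  "branch v = min n (max 1 (v div m))"

text \<open>Branch set 1 begins with row 0, hence the exception.\<close>

definition least_vertex :: "nat \<Rightarrow> nat" where
  "least_vertex y = (if y \<le> 1 then 0 else y * m)"

lemma branch_mult: "1 \<le> y \<Longrightarrow> y \<le> n \<Longrightarrow> j < m \<Longrightarrow> branch (y * m + j) = y"
  by (simp add: branch_def)

text \<open>The edge \<open>(a, b)\<close> is represented by step \<open>a\<close> of column code
  \<open>a * R + b\<close>, which leads from row \<open>a\<close> to row \<open>b\<close>.\<close>

lemma complete_graph_minor: "occurs_as_minor_of (complete_graph n) G"
proof (rule occurs_as_minor_ofI [where s = least_vertex and \<phi> = branch and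
      \<chi> = "\<lambda>(a, b). (a * R + b) * R + a"])
  fix v
  show "least_vertex (branch v) \<le> v"
  proof (cases "v div m \<le> 1")
    case True
    then show ?thesis
      using n by (simp add: branch_def least_vertex_def)
  next
    case False
    then have "least_vertex (branch v) \<le> v div m * m"
      by (simp add: branch_def least_vertex_def)
    then show ?thesis
      using div_times_less_eq_dividend order_trans by blast
  qed
  show "branch (least_vertex (branch v)) = branch v"
    using n m_ge by (auto simp: branch_def least_vertex_def)
  show "least_vertex (branch (Suc v)) = Suc v" if "branch (Suc v) \<noteq> branch v"
  proof -
    define q where "q = v div m"
    have mod: "Suc v mod m = 0"
    proof (rule ccontr)
      assume "Suc v mod m \<noteq> 0"
      then have "Suc v div m = v div m"
        unfolding div_Suc by (rule if_not_P)
      with that show False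
        unfolding branch_def by simp
    qed
    then have div: "Suc v div m = Suc q"
      unfolding div_Suc q_def by (rule if_P)
    have "min n (max 1 (Suc q)) \<noteq> min n (max 1 q)"
      using that unfolding branch_def div q_def .
    \<comment> \<open>Clamping identifies \<open>q\<close> and \<open>Suc q\<close> unless both lie
      in \<open>{1..n}\<close>.\<close>
    then have "1 \<le> q" "Suc q \<le> n"
      by linarith+
    then have "least_vertex (branch (Suc v)) = Suc q * m"
      unfolding branch_def least_vertex_def div by simp
    moreover have "Suc v = Suc q * m"
      using div_mult_mod_eq [of "Suc v" m] unfolding mod div by simp
    ultimately show ?thesis
      by simp
  qed
next
  have "y \<in> branch ` {..N}" if "y \<in> {1..n}" for y
    using that branch_mult [of y 0] grid_le [of y 0] m_ge R by (intro image_eqI [of _ _ "y * m"]) simp_all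
  then show "verts (complete_graph n) = branch ` {..N}"
    using n by (auto simp: complete_graph_def branch_def)
  show "inj_on (\<lambda>(a, b). (a * R + b) * R + a) (edges (complete_graph n))"
  proof (rule inj_onI, clarify)
    fix a b c d
    assume "(a, b) \<in> edges (complete_graph n)" "(c, d) \<in> edges (complete_graph n)"
      and eq: "(a * R + b) * R + a = (c * R + d) * R + c"
    then have "a < R" "c < R" "b < R" "d < R"
      by (auto simp: complete_graph_def R)
    then have "a = c" "a * R + b = c * R + d"
      using arg_cong [OF eq, of "\<lambda>x. x mod R"] arg_cong [OF eq, of "\<lambda>x. x div R"] by simp_all
    then show "a = c \<and> b = d"
      by simp
  qed
next
  fix f assume "f \<in> edges (complete_graph n)"
  then obtain a b where f: "f = (a, b)" "1 \<le> a" "a < b" "b \<le> n"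
    by (auto simp: complete_graph_def)
  define c where "c = a * R + b"
  have "b < R"
    using f by (simp add: R)
  then have c: "c div R = a" "c mod R = b"
    using R_pos by (simp_all add: c_def)
  have "c < R * R"
  proof -
    have "c < Suc a * R"
      using f by (simp add: c_def R)
    also have "\<dots> \<le> R * R"
      using f by (intro mult_le_mono1) (simp add: R)
    finally show ?thesis .
  qed
  then have "c < m"
    by (simp add: m)
  \<comment> \<open>Row \<open>a\<close> is not exchanged, being smaller than both
    \<open>Suc a\<close> and \<open>b\<close>; for \<open>b = Suc a\<close> the exchange is
    trivial.\<close>
  have row: "row c a = a" "row c (Suc a) = b"
    using f by (simp_all add: row_def c transpose_def)
  have "c * R + Suc a < Suc c * R"
    using f by (simp add: R)
  also have "\<dots> \<le> m * R"
    using \<open>c < m\<close> by (intro mult_le_mono1) simp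
  finally have "c * R + a < N"
    using N by (simp add: mult.commute)
  then show "(case f of (a, b) \<Rightarrow> (a * R + b) * R + a) < N"
    by (simp add: f c_def)
  have "a < R" "Suc a < R"
    using f by (simp_all add: R)
  then have "perm (c * R + a) = a * m + (m - 1 - c)" "perm (Suc (c * R + a)) = b * m + (m - 1 - c)"
    using perm_eq [of a c] perm_eq [of "Suc a" c] by (simp_all add: row)
  moreover have "branch (a * m + (m - 1 - c)) = a" "branch (b * m + (m - 1 - c)) = b"
    using f \<open>c < m\<close> by (intro branch_mult; simp)+
  ultimately have "branch (perm (c * R + a)) = a" "branch (perm (Suc (c * R + a))) = b"
    by simp_all
  then show "ends (complete_graph n) f =
      Upair (branch (perm (case f of (a, b) \<Rightarrow> (a * R + b) * R + a)))
        (branch (perm (Suc (case f of (a, b) \<Rightarrow> (a * R + b) * R + a))))"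
    by (simp add: f complete_graph_def flip: c_def)
qed

end

theorem lemma11:
  fixes n :: nat
  assumes "n \<ge> 2"
  shows "\<exists>G :: (nat, nat) multigraph.
    finite_multigraph G \<and> primitive_divergent G \<and> in_phi4 G \<and> occurs_as_minor_of (complete_graph n) G"
proof -
  interpret complete_graph_grid n "n + 2" "(n + 2) * (n + 2)" "(n + 2) * ((n + 2) * (n + 2)) - 1"
    by (rule complete_graph_grid.intro) (use assms in simp_all)
  show ?thesis
    by (rule exI, intro conjI) (rule finite_multigraph, rule primitive_divergent, rule in_phi4, rule complete_graph_minor)
qed

end
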